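(* Let $f\in\mathcal{C}_{e}$ with $f(z)=z+a_2z^2+a_3z^3+\cdots$. Then $$|a_6|\le \frac{587}{10800}\approx 0.0543519\qquad\text{and}\qquad |a_7|\le 0.0343723.$$
   Context: Let $\mathbb{D}=\{z\in\mathbb{C}:|z|<1\}$ and let $\mathcal{A}$ be the set of analytic functions $f$ on $\mathbb{D}$ of the form $f(z)=z+a_2z^2+a_3z^3+\cdots$. For functions $h_1,h_2$ analytic on $\mathbb{D}$, $h_1\prec h_2$ ($h_1$ is subordinate to $h_2$) means that there is a Schwarz function $w$, i.e. an analytic $w$ on $\mathbb{D}$ with $w(0)=0$ and $|w(z)|\le|z|$, such that $h_1(z)=h_2(w(z))$ on $\mathbb{D}$. The class $\mathcal{C}_{e}$ is $$\mathcal{C}_{e}=\left\{f\in\mathcal{A}:1+\frac{zf''(z)}{f'(z)}\prec e^{z}\right\}.$$ *)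

theory Defs
  imports "HOL-Complex_Analysis.Complex_Analysis"
begin

abbreviation unit_disc :: "complex set" where
  "unit_disc \<equiv> ball 0 1"

definition normalized_expansion :: "(complex \<Rightarrow> complex) \<Rightarrow> (nat \<Rightarrow> complex) \<Rightarrow> bool" where
  "normalized_expansion f a \<longleftrightarrow>
     a 0 = 0 \<and> a 1 = 1 \<and> (\<forall>z\<in>unit_disc. (\<lambda>n. a n * z ^ n) sums f z)"

definition class_A :: "(complex \<Rightarrow> complex) set" where
  "class_A = {f. f holomorphic_on unit_disc \<and> (\<exists>a. normalized_expansion f a)}"

definition schwarz_function :: "(complex \<Rightarrow> complex) \<Rightarrow> bool" where
  "schwarz_function w \<longleftrightarrow>
     w holomorphic_on unit_disc \<and> w 0 = 0 \<and> (\<forall>z\<in>unit_disc. norm (w z) \<le> norm z)"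

definition subordinate :: "(complex \<Rightarrow> complex) \<Rightarrow> (complex \<Rightarrow> complex) \<Rightarrow> bool"
    (infix "\<prec>\<^sub>s" 50) where
  "h1 \<prec>\<^sub>s h2 \<longleftrightarrow>
     h1 holomorphic_on unit_disc \<and> h2 holomorphic_on unit_disc \<and>
     (\<exists>w. schwarz_function w \<and> (\<forall>z\<in>unit_disc. h1 z = h2 (w z)))"

text \<open>The convention \<open>x / 0 = 0\<close> does not enlarge the class: since \<open>f'\<close> equals \<open>1\<close> at the origin,
  any zero of \<open>f'\<close> in the disc is an isolated pole of \<open>z f'' / f'\<close> away from the origin, so the
  left-hand side is not holomorphic there whatever value it is given at the point itself.\<close>

definition class_C_e :: "(complex \<Rightarrow> complex) set" where
  "class_C_e = {f \<in> class_A. (\<lambda>z. 1 + z * deriv (deriv f) z / deriv f z) \<prec>\<^sub>s exp}"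

end

theory Submission
  imports Defs
begin

text \<open>
  Let \<open>f\<close> be in the class, with Schwarz function \<open>w = \<Sum> c\<^sub>k z\<^sup>k\<close>, and write
  \<open>f' = \<Sum> b\<^sub>k z\<^sup>k\<close>, so that \<open>b\<^sub>k = (k + 1) a\<^sub>k\<^sub>+\<^sub>1\<close>. The subordination says
  \<open>z f'' = f' (e\<^sup>w - 1)\<close>. Since \<open>e\<^sup>w - 1\<close> is divisible by \<open>w\<close>, this is a factorization
  \<open>z f'' = w H\<close> with \<open>H = f' (e\<^sup>w - 1) / w = \<Sum> e\<^sub>k z\<^sup>k\<close> (lemma \<open>class_C_e_factorization\<close>).

  Because \<open>w 0 = 0\<close> and \<open>\<bar>w\<bar> \<le> 1\<close>, Clunie's method extracts from this factorization
  the inequality \<open>\<Sum>\<^sub>k\<^sub>\<le>\<^sub>n k\<^sup>2 \<bar>b\<^sub>k\<bar>\<^sup>2 \<le> \<Sum>\<^sub>k\<^sub><\<^sub>n \<bar>e\<^sub>k\<bar>\<^sup>2\<close> (theorem \<open>Clunie_inequality\<close>), which gives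
  \<open>n\<^sup>2 \<bar>b\<^sub>n\<bar>\<^sup>2 \<le> 1 + \<Sum>\<^sub>0\<^sub><\<^sub>k\<^sub><\<^sub>n (\<bar>e\<^sub>k\<bar>\<^sup>2 - k\<^sup>2 \<bar>b\<^sub>k\<bar>\<^sup>2)\<close>. Only the excesses \<open>\<bar>e\<^sub>k\<bar>\<^sup>2 - k\<^sup>2 \<bar>b\<^sub>k\<bar>\<^sup>2\<close>
  with \<open>k \<le> 5\<close> matter for \<open>a\<^sub>6\<close> and \<open>a\<^sub>7\<close>, and they are small for a structural reason: as polynomials in
  \<open>c\<^sub>1, \<dots>, c\<^sub>5\<close>, the quantities \<open>e\<^sub>k\<close> and \<open>k b\<^sub>k\<close> have the same monomials, and for \<open>k \<ge> 3\<close> the ratios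
  of their coefficients are all close to one number \<open>\<theta>\<^sub>k < 1\<close>. Hence \<open>e\<^sub>k = \<theta>\<^sub>k k b\<^sub>k + r\<^sub>k\<close> with a tiny
  remainder \<open>r\<^sub>k\<close>, and the excess is at most \<open>\<bar>r\<^sub>k\<bar>\<^sup>2 / (1 - \<theta>\<^sub>k\<^sup>2)\<close>, whatever \<open>b\<^sub>k\<close> is. The excesses for
  \<open>k = 1, 2\<close> are explicit in \<open>\<bar>c\<^sub>1\<bar>\<close> and \<open>\<bar>c\<^sub>2\<bar>\<close>. All of them are controlled by \<open>\<Sum> \<bar>c\<^sub>k\<bar>\<^sup>2 \<le> 1\<close>,
  which is Clunie's inequality again, for \<open>w = w \<cdot> 1\<close>.

  Altogether \<open>n\<^sup>2 \<bar>b\<^sub>n\<bar>\<^sup>2 \<le> 83/40\<close> for \<open>n = 5, 6\<close>, that is \<open>\<bar>a\<^sub>6\<bar> \<le> \<surd>(83/40) / 30 < 0.0481\<close> and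
  \<open>\<bar>a\<^sub>7\<bar> \<le> \<surd>(83/40) / 42 < 0.0343\<close>.
\<close>

section \<open>Clunie's inequality\<close>

text \<open>On the circle of radius \<open>r\<close> the conjugate of \<open>z\<^sup>k\<close> equals \<open>r\<^sup>2\<^sup>k / z\<^sup>k\<close>, so this is Cauchy's
  integral formula for the \<open>k\<close>-th derivative at the centre.\<close>

lemma coefficient_circle_integral:
  assumes "f holomorphic_on ball 0 1" "0 < r" "r < 1"
  shows "((\<lambda>t. f (of_real r * cis t) * cnj ((of_real r * cis t) ^ k)) has_integral
           of_real (2 * pi * r ^ (2 * k)) * fps_nth (fps_expansion f 0) k) {0..2 * pi}"
proof -
  let ?c = "fps_nth (fps_expansion f 0) k"
  let ?z = "\<lambda>t. of_real r * cis t :: complex"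
  have sub: "cball (0::complex) r \<subseteq> ball 0 1" using assms by auto
  have "((\<lambda>u. f u / (u - 0) ^ Suc k) has_contour_integral
          2 * pi * \<i> / fact k * (deriv ^^ k) f 0) (circlepath 0 r)"
    using assms sub
    by (intro Cauchy_has_contour_integral_higher_derivative_circlepath)
       (auto intro!: holomorphic_on_imp_continuous_on intro: holomorphic_on_subset)
  then have "((\<lambda>t. f (?z t) / ?z t ^ Suc k * of_real r * \<i> * cis t) has_integral
               (2 * pi * \<i> * ?c)) {0..2 * pi}"
    by (simp add: circlepath_def has_contour_integral_part_circlepath_iff fps_expansion_def)
  from has_integral_mult_right[OF this, of "of_real (r ^ (2 * k)) / \<i>"]
  have "((\<lambda>t. of_real (r ^ (2 * k)) / \<i> * (f (?z t) / ?z t ^ Suc k * of_real r * \<i> * cis t))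
           has_integral of_real (2 * pi * r ^ (2 * k)) * ?c) {0..2 * pi}"
    by (simp add: field_simps)
  moreover have "of_real (r ^ (2 * k)) / \<i> * (f (?z t) / ?z t ^ Suc k * of_real r * \<i> * cis t)
      = f (?z t) * cnj (?z t ^ k)" for t
  proof -
    have "?z t \<noteq> 0" using assms by simp
    moreover have "?z t ^ k * cnj (?z t ^ k) = of_real (r ^ (2 * k))"
      by (simp add: power_mult_distrib power_mult power2_eq_square cis_cnj Complex.DeMoivre cis_mult
          flip: mult.assoc)
    ultimately show ?thesis
      by (simp add: field_simps)
  qed
  ultimately show ?thesis by simp
qed

lemma circle_integral_against_polynomial:
  assumes "f holomorphic_on ball 0 1" "0 < r" "r < 1"
  shows "((\<lambda>t. f (of_real r * cis t) * cnj (\<Sum>k<n. p k * (of_real r * cis t) ^ k)) has_integral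
           of_real (2 * pi) * (\<Sum>k<n. cnj (p k) * of_real (r ^ (2 * k)) * fps_nth (fps_expansion f 0) k))
         {0..2 * pi}"
proof -
  have "((\<lambda>t. \<Sum>k<n. cnj (p k) * (f (of_real r * cis t) * cnj ((of_real r * cis t) ^ k))) has_integral
          (\<Sum>k<n. cnj (p k) * (of_real (2 * pi * r ^ (2 * k)) * fps_nth (fps_expansion f 0) k)))
         {0..2 * pi}"
    by (intro has_integral_sum has_integral_mult_right coefficient_circle_integral assms) auto
  then show ?thesis
    by (simp add: sum_distrib_left mult_ac)
qed

lemma fps_expansion_polynomial:
  "fps_nth (fps_expansion (\<lambda>z. \<Sum>k<n. p k * z ^ k) 0) m = (if m < n then p m else 0)"
proof -
  have "(\<lambda>z::complex. \<Sum>k<n. p k * z ^ k) has_fps_expansion (\<Sum>k<n. fps_const (p k) * fps_X ^ k)"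
    by (intro fps_expansion_intros)
  from fps_expansion_eqI[OF this] show ?thesis
    by (simp add: fps_sum_nth fps_X_power_nth if_distrib sum.delta cong: if_cong)
qed

lemma weighted_norm_square_sum:
  "complex_of_real (\<Sum>k\<in>K. (norm (p k))\<^sup>2 * x k) = (\<Sum>k\<in>K. cnj (p k) * of_real (x k) * p k)"
  by (simp only: of_real_sum of_real_mult complex_norm_square mult_ac)

text \<open>Parseval's identity, obtained by pairing a polynomial with itself.\<close>

lemma circle_mean_square_polynomial:
  assumes "0 < r" "r < 1"
  shows "((\<lambda>t. (norm (\<Sum>k<n. p k * (of_real r * cis t) ^ k))\<^sup>2) has_integral
           2 * pi * (\<Sum>k<n. (norm (p k))\<^sup>2 * r ^ (2 * k))) {0..2 * pi}"
proof -
  let ?P = "\<lambda>z. \<Sum>k<n. p k * z ^ k"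
  have "((\<lambda>t. ?P (of_real r * cis t) * cnj (?P (of_real r * cis t))) has_integral
      of_real (2 * pi) * (\<Sum>k<n. cnj (p k) * of_real (r ^ (2 * k)) * fps_nth (fps_expansion ?P 0) k))
      {0..2 * pi}"
    by (intro circle_integral_against_polynomial assms holomorphic_intros)
  then have "((\<lambda>t. complex_of_real ((norm (?P (of_real r * cis t)))\<^sup>2)) has_integral
      complex_of_real (2 * pi * (\<Sum>k<n. (norm (p k))\<^sup>2 * r ^ (2 * k)))) {0..2 * pi}"
    unfolding complex_norm_square of_real_mult[of "2 * pi"] weighted_norm_square_sum
    by (simp add: fps_expansion_polynomial)
  then show ?thesis
    by (drule_tac has_integral_Re) (simp only: Re_complex_of_real)
qed

lemma circle_norm_square_integrable:
  assumes "f holomorphic_on ball 0 1" "0 < r" "r < 1"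
  shows "(\<lambda>t. (norm (f (of_real r * cis t)))\<^sup>2) integrable_on {a..b}"
proof -
  have "continuous_on (ball 0 1) f"
    using assms holomorphic_on_imp_continuous_on by blast
  then have "continuous_on {a..b} (\<lambda>t. f (of_real r * cis t))"
    by (rule continuous_on_compose2) (use assms in \<open>auto intro!: continuous_intros simp: norm_mult\<close>)
  then show ?thesis
    by (intro integrable_continuous_interval continuous_intros)
qed

text \<open>The mean square of \<open>f\<close> minus its Taylor polynomial is nonnegative; expanding the square, both
  the cross term and the square of the Taylor polynomial integrate to the sum on the left-hand side.\<close>

lemma Bessel_inequality_circle:
  assumes f: "f holomorphic_on ball 0 1" and r: "0 < r" "r < 1"
  shows "2 * pi * (\<Sum>k<n. (norm (fps_nth (fps_expansion f 0) k))\<^sup>2 * r ^ (2 * k))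
           \<le> integral {0..2 * pi} (\<lambda>t. (norm (f (of_real r * cis t)))\<^sup>2)"
proof -
  let ?c = "fps_nth (fps_expansion f 0)"
  let ?z = "\<lambda>t. of_real r * cis t :: complex"
  let ?S = "\<lambda>z. \<Sum>k<n. ?c k * z ^ k"
  let ?s = "2 * pi * (\<Sum>k<n. (norm (?c k))\<^sup>2 * r ^ (2 * k))"
  have "(\<lambda>t. (norm (f (?z t)))\<^sup>2) integrable_on {0..2 * pi}"
    by (rule circle_norm_square_integrable[OF f r])
  then have I: "((\<lambda>t. (norm (f (?z t)))\<^sup>2) has_integral
      integral {0..2 * pi} (\<lambda>t. (norm (f (?z t)))\<^sup>2)) {0..2 * pi}"
    by (simp add: has_integral_integral)
  have "((\<lambda>t. f (?z t) * cnj (?S (?z t))) has_integral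
      of_real (2 * pi) * (\<Sum>k<n. cnj (?c k) * of_real (r ^ (2 * k)) * ?c k)) {0..2 * pi}"
    by (intro circle_integral_against_polynomial assms)
  then have "((\<lambda>t. f (?z t) * cnj (?S (?z t))) has_integral complex_of_real ?s) {0..2 * pi}"
    unfolding of_real_mult[of "2 * pi"] weighted_norm_square_sum .
  then have X: "((\<lambda>t. Re (f (?z t) * cnj (?S (?z t)))) has_integral ?s) {0..2 * pi}"
    by (drule_tac has_integral_Re) (simp only: Re_complex_of_real)
  have "((\<lambda>t. (norm (f (?z t)))\<^sup>2 - 2 * Re (f (?z t) * cnj (?S (?z t))) + (norm (?S (?z t)))\<^sup>2)
      has_integral (integral {0..2 * pi} (\<lambda>t. (norm (f (?z t)))\<^sup>2) - 2 * ?s + ?s)) {0..2 * pi}"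
    by (intro has_integral_add has_integral_diff has_integral_mult_right I X
        circle_mean_square_polynomial r)
  moreover have "0 \<le> (norm a)\<^sup>2 - 2 * Re (a * cnj b) + (norm b)\<^sup>2" for a b :: complex
    using zero_le_power2[of "norm (a - b)"] unfolding cmod_power2
    by (simp add: power2_eq_square algebra_simps)
  ultimately have "0 \<le> integral {0..2 * pi} (\<lambda>t. (norm (f (?z t)))\<^sup>2) - 2 * ?s + ?s"
    by (rule has_integral_nonneg)
  then show ?thesis by simp
qed

text \<open>
  Replacing \<open>H\<close> by its Taylor polynomial \<open>P\<close> of degree below \<open>n\<close> does not change the coefficients
  of \<open>w H\<close> up to order \<open>n\<close>, because \<open>w 0 = 0\<close> shifts every power by at least one. On each circle
  \<open>\<bar>w P\<bar> \<le> \<bar>P\<bar>\<close>, so Bessel's inequality for \<open>w P\<close> and Parseval's identity for \<open>P\<close> give the claim with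
  weights \<open>r\<^sup>2\<^sup>k\<close>, and \<open>r\<close> tends to \<open>1\<close>.
\<close>

theorem Clunie_inequality:
  assumes w: "w holomorphic_on ball 0 1" "w 0 = 0" "\<And>z. z \<in> ball 0 1 \<Longrightarrow> norm (w z) \<le> 1"
    and H: "H holomorphic_on ball 0 1"
  shows "(\<Sum>k\<le>n. (norm (fps_nth (fps_expansion (\<lambda>z. w z * H z) 0) k))\<^sup>2)
           \<le> (\<Sum>k<n. (norm (fps_nth (fps_expansion H 0) k))\<^sup>2)"
proof -
  define h where "h = fps_nth (fps_expansion H 0)"
  define P where "P = (\<lambda>z::complex. \<Sum>k<n. h k * z ^ k)"
  have P: "P holomorphic_on ball 0 1"
    unfolding P_def by (intro holomorphic_intros)
  have expansion: "f has_fps_expansion fps_expansion f 0" if "f holomorphic_on ball 0 1" for f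
    using that by (intro has_fps_expansion_fps_expansion[of "ball 0 1"]) auto
  define W where "W = fps_expansion w 0"
  have W0: "fps_nth W 0 = 0"
    using w by (simp add: W_def fps_expansion_def)
  have "fps_expansion (\<lambda>z. w z * H z) 0 = W * fps_expansion H 0"
    "fps_expansion (\<lambda>z. w z * P z) 0 = W * fps_expansion P 0"
    unfolding W_def
    by (intro fps_expansion_eqI has_fps_expansion_mult expansion w H P)+
  moreover have "fps_nth (W * fps_expansion H 0) k = fps_nth (W * fps_expansion P 0) k" if "k \<le> n" for k
    unfolding fps_mult_nth
  proof (intro sum.cong refl)
    fix i assume "i \<in> {0..k}"
    then show "fps_nth W i * fps_nth (fps_expansion H 0) (k - i) =
        fps_nth W i * fps_nth (fps_expansion P 0) (k - i)"
      using that W0 by (cases "i = 0") (auto simp: P_def fps_expansion_polynomial h_def)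
  qed
  ultimately have same: "fps_nth (fps_expansion (\<lambda>z. w z * H z) 0) k =
      fps_nth (fps_expansion (\<lambda>z. w z * P z) 0) k" if "k \<le> n" for k
    using that by simp
  define g where "g = fps_nth (fps_expansion (\<lambda>z. w z * P z) 0)"
  have G: "(\<lambda>z. w z * P z) holomorphic_on ball 0 1"
    by (intro holomorphic_intros w P)
  have ineq: "(\<Sum>k\<le>n. (norm (g k))\<^sup>2 * r ^ (2 * k)) \<le> (\<Sum>k<n. (norm (h k))\<^sup>2 * r ^ (2 * k))"
    if r: "0 < r" "r < 1" for r :: real
  proof -
    let ?z = "\<lambda>t. of_real r * cis t :: complex"
    have "(\<lambda>t. (norm (w (?z t) * P (?z t)))\<^sup>2) integrable_on {0..2 * pi}"
      by (rule circle_norm_square_integrable[OF G r])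
    moreover have "(norm (w (?z t) * P (?z t)))\<^sup>2 \<le> (norm (P (?z t)))\<^sup>2" for t
    proof -
      have "norm (w (?z t)) \<le> 1"
        using r by (intro w(3)) (simp add: norm_mult)
      then show ?thesis
        unfolding norm_mult by (intro power_mono mult_left_le_one_le) simp_all
    qed
    ultimately have "integral {0..2 * pi} (\<lambda>t. (norm (w (?z t) * P (?z t)))\<^sup>2)
        \<le> 2 * pi * (\<Sum>k<n. (norm (h k))\<^sup>2 * r ^ (2 * k))"
      by (intro has_integral_le[OF integrable_integral circle_mean_square_polynomial[OF r, of h n]])
         (simp_all add: P_def)
    then have "2 * pi * (\<Sum>k<Suc n. (norm (g k))\<^sup>2 * r ^ (2 * k))
        \<le> 2 * pi * (\<Sum>k<n. (norm (h k))\<^sup>2 * r ^ (2 * k))"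
      using Bessel_inequality_circle[OF G r, of "Suc n"] unfolding g_def by linarith
    then show ?thesis by (simp add: lessThan_Suc_atMost)
  qed
  have "(\<Sum>k\<le>n. (norm (g k))\<^sup>2 * 1 ^ (2 * k)) \<le> (\<Sum>k<n. (norm (h k))\<^sup>2 * 1 ^ (2 * k))"
  proof (rule tendsto_le)
    show "((\<lambda>r. \<Sum>k<n. (norm (h k))\<^sup>2 * r ^ (2 * k)) \<longlongrightarrow> (\<Sum>k<n. (norm (h k))\<^sup>2 * 1 ^ (2 * k))) (at_left 1)"
      "((\<lambda>r. \<Sum>k\<le>n. (norm (g k))\<^sup>2 * r ^ (2 * k)) \<longlongrightarrow> (\<Sum>k\<le>n. (norm (g k))\<^sup>2 * 1 ^ (2 * k))) (at_left 1)"
      by (intro tendsto_intros)+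
    show "\<forall>\<^sub>F r in at_left 1. (\<Sum>k\<le>n. (norm (g k))\<^sup>2 * r ^ (2 * k)) \<le> (\<Sum>k<n. (norm (h k))\<^sup>2 * r ^ (2 * k))"
      by (rule eventually_at_leftI[of 0]) (auto intro: ineq)
  qed simp
  then have "(\<Sum>k\<le>n. (norm (g k))\<^sup>2) \<le> (\<Sum>k<n. (norm (h k))\<^sup>2)"
    by (simp only: power_one mult_1_right)
  moreover have "(\<Sum>k\<le>n. (norm (fps_nth (fps_expansion (\<lambda>z. w z * H z) 0) k))\<^sup>2) = (\<Sum>k\<le>n. (norm (g k))\<^sup>2)"
    unfolding g_def by (intro sum.cong refl arg_cong[where f = "\<lambda>x. (norm x)\<^sup>2"] same) simp
  ultimately show ?thesis
    by (simp only: h_def)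
qed

section \<open>Factorization of \<open>z f''\<close> through the Schwarz function\<close>

definition exp_quotient :: "complex \<Rightarrow> complex" where
  "exp_quotient u = (if u = 0 then 1 else (exp u - 1) / u)"

definition exp_quotient_fps :: "complex fps" where
  "exp_quotient_fps = Abs_fps (\<lambda>n. 1 / fact (Suc n))"

lemma exp_quotient_mult: "u * exp_quotient u = exp u - 1"
  by (simp add: exp_quotient_def)

lemma exp_quotient_holomorphic: "exp_quotient holomorphic_on UNIV"
proof (rule pole_theorem_open_0[where a = 0 and g = "\<lambda>u. exp u - 1"])
  have "((\<lambda>u::complex. exp u - 1) has_field_derivative 1) (at 0)"
    by (auto intro!: derivative_eq_intros)
  then show "exp_quotient 0 = deriv (\<lambda>u. exp u - 1) 0"
    by (simp add: exp_quotient_def DERIV_imp_deriv)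
qed (auto intro!: holomorphic_intros simp: exp_quotient_def)

lemma exp_quotient_expansion: "exp_quotient has_fps_expansion exp_quotient_fps"
proof -
  let ?F = "fps_expansion exp_quotient 0"
  have F: "exp_quotient has_fps_expansion ?F"
    using exp_quotient_holomorphic by (intro has_fps_expansion_fps_expansion[of UNIV]) auto
  have "(\<lambda>u. u * exp_quotient u) has_fps_expansion fps_X * ?F"
    by (intro fps_expansion_intros F)
  moreover have "(\<lambda>u::complex. exp u - 1) has_fps_expansion fps_exp 1 - 1"
    by (intro fps_expansion_intros)
  ultimately have "fps_X * ?F = fps_exp 1 - 1"
    unfolding exp_quotient_mult by (rule fps_expansion_unique_complex)
  then have "fps_nth (fps_X * ?F) (Suc n) = fps_nth (fps_exp 1 - 1) (Suc n)" for n
    by simp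
  then have "?F = exp_quotient_fps"
    by (simp add: fps_eq_iff exp_quotient_fps_def algebra_simps)
  with F show ?thesis by simp
qed

lemma normalized_expansion_imp_fps:
  assumes "normalized_expansion f a"
  shows "f has_fps_expansion Abs_fps a"
proof (rule has_fps_expansionI)
  have "eventually (\<lambda>z. z \<in> unit_disc) (nhds (0::complex))"
    by (intro eventually_nhds_in_open) auto
  then show "\<forall>\<^sub>F z in nhds 0. (\<lambda>n. fps_nth (Abs_fps a) n * z ^ n) sums f z"
    by eventually_elim (use assms in \<open>auto simp: normalized_expansion_def\<close>)
qed

text \<open>
  The power series of \<open>w H\<close> is read off near the origin: there \<open>f'\<close> does not vanish, so the quotient in
  the definition of the class is a genuine one and can be multiplied out to \<open>z f'' = w H\<close>. The function
  \<open>H\<close> is holomorphic on the whole disc, as Clunie's inequality requires.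
\<close>

lemma class_C_e_factorization:
  assumes f: "f \<in> class_C_e" and a: "normalized_expansion f a"
  obtains w H where "schwarz_function w" "H holomorphic_on unit_disc"
    "fps_expansion H 0 = fps_deriv (Abs_fps a) * (exp_quotient_fps oo fps_expansion w 0)"
    "fps_expansion (\<lambda>z. w z * H z) 0 = fps_X * fps_deriv (fps_deriv (Abs_fps a))"
proof -
  from f obtain w where hf: "f holomorphic_on unit_disc" and w: "schwarz_function w"
    and eq: "\<And>z. z \<in> unit_disc \<Longrightarrow> 1 + z * deriv (deriv f) z / deriv f z = exp (w z)"
    by (auto simp: class_C_e_def class_A_def subordinate_def)
  have hw: "w holomorphic_on unit_disc" and w0: "w 0 = 0"
    using w by (auto simp: schwarz_function_def)
  define H where "H = (\<lambda>z. deriv f z * exp_quotient (w z))"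
  have hH: "H holomorphic_on unit_disc"
    unfolding H_def using holomorphic_on_compose_gen[OF hw exp_quotient_holomorphic]
    by (intro holomorphic_intros hf) (auto simp: o_def)
  have F: "f has_fps_expansion Abs_fps a"
    by (rule normalized_expansion_imp_fps[OF a])
  have F': "deriv f has_fps_expansion fps_deriv (Abs_fps a)"
    by (intro has_fps_expansion_deriv F)
  have W: "w has_fps_expansion fps_expansion w 0"
    by (intro has_fps_expansion_fps_expansion[of unit_disc] hw) auto
  have "(exp_quotient \<circ> w) has_fps_expansion (exp_quotient_fps oo fps_expansion w 0)"
    by (intro has_fps_expansion_compose exp_quotient_expansion W) (simp add: fps_expansion_def w0)
  then have H: "H has_fps_expansion fps_deriv (Abs_fps a) * (exp_quotient_fps oo fps_expansion w 0)"
    unfolding H_def using has_fps_expansion_mult[OF F'] by (simp add: o_def)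
  have "deriv f 0 = 1"
    using has_fps_expansion_imp_0_eq_fps_nth_0[OF F'] a by (simp add: normalized_expansion_def)
  moreover have "isCont (deriv f) 0"
    using has_fps_expansion_imp_continuous[OF F', of UNIV] by simp
  ultimately have "\<forall>\<^sub>F z in nhds 0. deriv f z \<noteq> 0"
    by (intro tendsto_imp_eventually_ne[where c = 1]) (auto simp: isCont_def tendsto_nhds_iff)
  moreover have "\<forall>\<^sub>F z in nhds (0::complex). z \<in> unit_disc"
    by (intro eventually_nhds_in_open) auto
  ultimately have "\<forall>\<^sub>F z in nhds 0. z * deriv (deriv f) z = w z * H z"
  proof eventually_elim
    case (elim z)
    have "w z * H z = deriv f z * (exp (w z) - 1)"
      unfolding H_def exp_quotient_mult[symmetric] by simp
    also have "\<dots> = z * deriv (deriv f) z"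
      using elim by (simp add: eq[symmetric])
    finally show ?case ..
  qed
  moreover have "(\<lambda>z. z * deriv (deriv f) z) has_fps_expansion fps_X * fps_deriv (fps_deriv (Abs_fps a))"
    by (intro fps_expansion_intros F)
  ultimately have "(\<lambda>z. w z * H z) has_fps_expansion fps_X * fps_deriv (fps_deriv (Abs_fps a))"
    by (rule has_fps_expansion_cong[THEN iffD1, OF _ refl])
  then show thesis
    using that[OF w hH] H by (simp add: fps_expansion_eqI)
qed

section \<open>The first coefficients as polynomials in those of the Schwarz function\<close>

lemma exp_quotient_compose_coeffs:
  assumes "fps_nth W 0 = 0"
  defines "c \<equiv> fps_nth W" and "q \<equiv> fps_nth (exp_quotient_fps oo W)"
  shows "q 0 = 1" "q 1 = c 1 / 2" "q 2 = c 2 / 2 + c 1 ^ 2 / 6"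
    "q 3 = c 3 / 2 + c 1 * c 2 / 3 + c 1 ^ 3 / 24"
    "q 4 = c 4 / 2 + c 1 * c 3 / 3 + c 2 ^ 2 / 6 + c 1 ^ 2 * c 2 / 8 + c 1 ^ 4 / 120"
    "q 5 = c 5 / 2 + c 1 * c 4 / 3 + c 2 * c 3 / 3 + c 1 ^ 2 * c 3 / 8 + c 1 * c 2 ^ 2 / 8
       + c 1 ^ 3 * c 2 / 30 + c 1 ^ 5 / 720"
proof -
  have c: "c 0 = 0" "fps_nth W n = c n" for n
    using assms(1) by (simp_all add: c_def)
  have power_Suc_coeff: "fps_nth (W ^ Suc i) n = (\<Sum>j=0..n. c j * fps_nth (W ^ i) (n - j))" for i n
    by (simp add: fps_mult_nth c_def)
  have q: "q n = (\<Sum>i=0..n. fps_nth (W ^ i) n / fact (Suc i))" for n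
    by (simp add: q_def fps_compose_nth exp_quotient_fps_def)
  show "q 0 = 1" "q 1 = c 1 / 2" "q 2 = c 2 / 2 + c 1 ^ 2 / 6"
    "q 3 = c 3 / 2 + c 1 * c 2 / 3 + c 1 ^ 3 / 24"
    "q 4 = c 4 / 2 + c 1 * c 3 / 3 + c 2 ^ 2 / 6 + c 1 ^ 2 * c 2 / 8 + c 1 ^ 4 / 120"
    "q 5 = c 5 / 2 + c 1 * c 4 / 3 + c 2 * c 3 / 3 + c 1 ^ 2 * c 3 / 8 + c 1 * c 2 ^ 2 / 8
       + c 1 ^ 3 * c 2 / 30 + c 1 ^ 5 / 720"
    unfolding q
    by (simp_all add: numeral_eq_Suc power_Suc_coeff sum.atLeast0_atMost_Suc c
      del: power_Suc) (simp_all add: field_simps)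
qed

text \<open>
  The hypotheses \<open>e\<close> and \<open>b\<close> are the coefficient forms of \<open>H = f' (e\<^sup>w - 1) / w\<close> and \<open>z f'' = w H\<close>.
  As \<open>c 0 = 0\<close>, the second one determines \<open>b n\<close> from the \<open>e k\<close> with \<open>k < n\<close>, and the first one then
  gives \<open>e n\<close>. The products \<open>n * b n\<close> are listed instead of \<open>b n\<close> because these are the quantities in
  Clunie's inequality.
\<close>

lemma coeffs_from_recurrences:
  fixes b c e q :: "nat \<Rightarrow> complex"
  assumes q: "q 0 = 1" "q 1 = c 1 / 2" "q 2 = c 2 / 2 + c 1 ^ 2 / 6"
      "q 3 = c 3 / 2 + c 1 * c 2 / 3 + c 1 ^ 3 / 24"
      "q 4 = c 4 / 2 + c 1 * c 3 / 3 + c 2 ^ 2 / 6 + c 1 ^ 2 * c 2 / 8 + c 1 ^ 4 / 120"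
      "q 5 = c 5 / 2 + c 1 * c 4 / 3 + c 2 * c 3 / 3 + c 1 ^ 2 * c 3 / 8 + c 1 * c 2 ^ 2 / 8
         + c 1 ^ 3 * c 2 / 30 + c 1 ^ 5 / 720"
    and e: "\<And>n. e n = (\<Sum>i=0..n. b i * q (n - i))"
    and b: "\<And>n. of_nat n * b n = (\<Sum>i=0..n. c i * e (n - i))"
    and init: "b 0 = 1" "c 0 = 0"
  shows "e 0 = 1" "b 1 = c 1" "e 1 = 3/2 * c 1"
    "2 * b 2 = 3/2 * c 1 ^ 2 + c 2" "e 2 = 17/12 * c 1 ^ 2 + c 2"
    "3 * b 3 = 17/12 * c 1 ^ 3 + 5/2 * c 1 * c 2 + c 3"
    "e 3 = 19/18 * c 1 ^ 3 + 23/12 * c 1 * c 2 + 5/6 * c 3"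
    "4 * b 4 = 19/18 * c 1 ^ 4 + 10/3 * c 1 ^ 2 * c 2 + 7/3 * c 1 * c 3 + c 2 ^ 2 + c 4"
    "e 4 = 27/40 * c 1 ^ 4 + 13/6 * c 1 ^ 2 * c 2 + 19/12 * c 1 * c 3 + 2/3 * c 2 ^ 2 + 3/4 * c 4"
    "5 * b 5 = 27/40 * c 1 ^ 5 + 29/9 * c 1 ^ 3 * c 2 + 3 * c 1 ^ 2 * c 3 + 31/12 * c 1 * c 2 ^ 2
       + 9/4 * c 1 * c 4 + 11/6 * c 2 * c 3 + c 5"
    "e 5 = 8351/21600 * c 1 ^ 5 + 1343/720 * c 1 ^ 3 * c 2 + 641/360 * c 1 ^ 2 * c 3 + 91/60 * c 1 * c 2 ^ 2
       + 169/120 * c 1 * c 4 + 67/60 * c 2 * c 3 + 7/10 * c 5"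
proof -
  show e0: "e 0 = 1" using e[of 0] by (simp add: q init)
  show b1: "b 1 = c 1" using b[of 1] by (simp add: e0 init)
  have e1: "e 1 = b 0 * q 1 + b 1 * q 0" using e[of 1] by simp
  show e1: "e 1 = 3/2 * c 1"
    unfolding e1 b1 q init by (simp add: field_simps)
  have "2 * b 2 = c 1 * e 1 + c 2 * e 0"
    using b[of 2] by (simp add: init eval_nat_numeral)
  then show b2: "2 * b 2 = 3/2 * c 1 ^ 2 + c 2"
    unfolding e1 e0 by (simp add: power2_eq_square)
  have e2: "e 2 = b 0 * q 2 + b 1 * q 1 + (2 * b 2) * q 0 / 2"
    using e[of 2] by (simp add: eval_nat_numeral)
  show e2: "e 2 = 17/12 * c 1 ^ 2 + c 2"
    unfolding e2 b2 b1 q init by (simp add: field_simps power2_eq_square)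
  have "3 * b 3 = c 1 * e 2 + c 2 * e 1 + c 3 * e 0"
    using b[of 3] by (simp add: init eval_nat_numeral)
  also have "\<dots> = 17/12 * c 1 ^ 3 + 5/2 * c 1 * c 2 + c 3"
    unfolding e2 e1 e0 by (simp add: field_simps eval_nat_numeral)
  finally show b3: "3 * b 3 = 17/12 * c 1 ^ 3 + 5/2 * c 1 * c 2 + c 3" .
  have e3: "e 3 = b 0 * q 3 + b 1 * q 2 + (2 * b 2) * q 1 / 2 + (3 * b 3) * q 0 / 3"
    using e[of 3] by (simp add: eval_nat_numeral)
  show e3: "e 3 = 19/18 * c 1 ^ 3 + 23/12 * c 1 * c 2 + 5/6 * c 3"
    unfolding e3 b3 b2 b1 q init by (simp add: field_simps eval_nat_numeral)
  have "4 * b 4 = c 1 * e 3 + c 2 * e 2 + c 3 * e 1 + c 4 * e 0"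
    using b[of 4] by (simp add: init eval_nat_numeral)
  also have "\<dots> = 19/18 * c 1 ^ 4 + 10/3 * c 1 ^ 2 * c 2 + 7/3 * c 1 * c 3 + c 2 ^ 2 + c 4"
    unfolding e3 e2 e1 e0 by (simp add: field_simps eval_nat_numeral)
  finally show b4: "4 * b 4 = 19/18 * c 1 ^ 4 + 10/3 * c 1 ^ 2 * c 2 + 7/3 * c 1 * c 3 + c 2 ^ 2 + c 4" .
  have e4: "e 4 = b 0 * q 4 + b 1 * q 3 + (2 * b 2) * q 2 / 2 + (3 * b 3) * q 1 / 3 + (4 * b 4) * q 0 / 4"
    using e[of 4] by (simp add: eval_nat_numeral)
  show e4: "e 4 = 27/40 * c 1 ^ 4 + 13/6 * c 1 ^ 2 * c 2 + 19/12 * c 1 * c 3 + 2/3 * c 2 ^ 2 + 3/4 * c 4"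
    unfolding e4 b4 b3 b2 b1 q init by (simp add: field_simps eval_nat_numeral)
  have "5 * b 5 = c 1 * e 4 + c 2 * e 3 + c 3 * e 2 + c 4 * e 1 + c 5 * e 0"
    using b[of 5] by (simp add: init eval_nat_numeral)
  also have "\<dots> = 27/40 * c 1 ^ 5 + 29/9 * c 1 ^ 3 * c 2 + 3 * c 1 ^ 2 * c 3 + 31/12 * c 1 * c 2 ^ 2
       + 9/4 * c 1 * c 4 + 11/6 * c 2 * c 3 + c 5"
    unfolding e4 e3 e2 e1 e0 by (simp add: field_simps eval_nat_numeral)
  finally show b5: "5 * b 5 = 27/40 * c 1 ^ 5 + 29/9 * c 1 ^ 3 * c 2 + 3 * c 1 ^ 2 * c 3 + 31/12 * c 1 * c 2 ^ 2
       + 9/4 * c 1 * c 4 + 11/6 * c 2 * c 3 + c 5" .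
  have e5: "e 5 = b 0 * q 5 + b 1 * q 4 + (2 * b 2) * q 3 / 2 + (3 * b 3) * q 2 / 3 + (4 * b 4) * q 1 / 4
      + (5 * b 5) * q 0 / 5"
    using e[of 5] by (simp add: eval_nat_numeral)
  show e5: "e 5 = 8351/21600 * c 1 ^ 5 + 1343/720 * c 1 ^ 3 * c 2 + 641/360 * c 1 ^ 2 * c 3 + 91/60 * c 1 * c 2 ^ 2
       + 169/120 * c 1 * c 4 + 67/60 * c 2 * c 3 + 7/10 * c 5"
    unfolding e5 b5 b4 b3 b2 b1 q init by (simp add: field_simps eval_nat_numeral)
qed

section \<open>Estimates for the excesses\<close>

lemma Cauchy_Schwarz_5:
  fixes a1 :: real
  shows "(a1 * x1 + a2 * x2 + a3 * x3 + a4 * x4 + a5 * x5)\<^sup>2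
     \<le> (a1\<^sup>2 + a2\<^sup>2 + a3\<^sup>2 + a4\<^sup>2 + a5\<^sup>2) * (x1\<^sup>2 + x2\<^sup>2 + x3\<^sup>2 + x4\<^sup>2 + x5\<^sup>2)"
  using Cauchy_Schwarz_ineq_sum[of "\<lambda>i. [a1, a2, a3, a4, a5] ! i" "\<lambda>i. [x1, x2, x3, x4, x5] ! i" "{..<5}"]
  by (simp add: eval_nat_numeral add.assoc)

text \<open>
  The bound is uniform in \<open>y\<close>: the maximum of \<open>(\<theta> Y + \<rho>)\<^sup>2 - Y\<^sup>2\<close> over real \<open>Y\<close> is
  \<open>\<rho>\<^sup>2 / (1 - \<theta>\<^sup>2)\<close>, by completing the square.
\<close>

lemma norm_square_near_multiple:
  fixes y r :: complex and \<theta> :: real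
  assumes "0 \<le> \<theta>" "\<theta> < 1" "(norm r)\<^sup>2 \<le> (1 - \<theta>\<^sup>2) * R"
  shows "(norm (of_real \<theta> * y + r))\<^sup>2 \<le> (norm y)\<^sup>2 + R"
proof -
  define q where "q = 1 - \<theta>\<^sup>2"
  have q: "0 < q"
    using assms power_strict_mono[of \<theta> 1 2] by (simp add: q_def)
  have "norm (of_real \<theta> * y + r) \<le> \<theta> * norm y + norm r"
    using norm_triangle_ineq[of "of_real \<theta> * y" r] assms by (simp add: norm_mult)
  then have "q * (norm (of_real \<theta> * y + r))\<^sup>2 \<le> q * (\<theta> * norm y + norm r)\<^sup>2"
    using q by (intro mult_left_mono power_mono) auto
  also have "\<dots> = q * (norm y)\<^sup>2 + (norm r)\<^sup>2 - (q * norm y - \<theta> * norm r)\<^sup>2"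
    unfolding q_def by algebra
  also have "\<dots> \<le> q * (norm y)\<^sup>2 + q * R"
    using assms(3) zero_le_power2[of "q * norm y - \<theta> * norm r"] unfolding q_def by linarith
  finally have "q * (norm (of_real \<theta> * y + r))\<^sup>2 \<le> q * ((norm y)\<^sup>2 + R)"
    by (simp add: algebra_simps)
  then show ?thesis using q by simp
qed

text \<open>
  In the total below, \<open>\<bar>c\<^sub>1\<bar>\<^sup>2\<close> and \<open>\<bar>c\<^sub>2\<bar>\<^sup>2\<close> already appear with sizeable coefficients, while
  \<open>c\<^sub>3, c\<^sub>4, c\<^sub>5\<close> enter through the remainders alone. Counting the latter with the factor \<open>4\<close> is
  therefore free of cost, and it reduces their share in the Cauchy-Schwarz estimate of the remainders.
\<close>

definition weighted_mass :: "(nat \<Rightarrow> complex) \<Rightarrow> real" where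
  "weighted_mass c = (norm (c 1))\<^sup>2 + (norm (c 2))\<^sup>2
     + (2 * norm (c 3))\<^sup>2 + (2 * norm (c 4))\<^sup>2 + (2 * norm (c 5))\<^sup>2"

lemma weighted_mass_nonneg: "0 \<le> weighted_mass c"
  by (simp add: weighted_mass_def)

context
  fixes c :: "nat \<Rightarrow> complex"
  assumes mass: "(norm (c 1))\<^sup>2 + (norm (c 2))\<^sup>2 + (norm (c 3))\<^sup>2 + (norm (c 4))\<^sup>2 + (norm (c 5))\<^sup>2 \<le> 1"
begin

lemma norm_c_le_1: "norm (c 1) \<le> 1" "norm (c 2) \<le> 1"
  by (rule power2_le_imp_le; use mass in \<open>simp; smt (verit) zero_le_power2\<close>)+

text \<open>The factor \<open>2\<close> in three of the bounds absorbs the weight of \<open>c\<^sub>3, c\<^sub>4, c\<^sub>5\<close>.\<close>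

lemma remainder_bound:
  assumes "norm A1 \<le> a1" "norm A2 \<le> a2" "norm A3 \<le> 2 * a3" "norm A4 \<le> 2 * a4" "norm A5 \<le> 2 * a5"
  shows "(norm (A1 * c 1 + A2 * c 2 + A3 * c 3 + A4 * c 4 + A5 * c 5))\<^sup>2
    \<le> (a1\<^sup>2 + a2\<^sup>2 + a3\<^sup>2 + a4\<^sup>2 + a5\<^sup>2) * weighted_mass c"
proof -
  have "norm (A1 * c 1 + A2 * c 2 + A3 * c 3 + A4 * c 4 + A5 * c 5)
     \<le> norm (A1 * c 1) + norm (A2 * c 2) + norm (A3 * c 3) + norm (A4 * c 4) + norm (A5 * c 5)"
    by (intro norm_triangle_mono order.refl)
  also have "\<dots> \<le> a1 * norm (c 1) + a2 * norm (c 2) + 2 * a3 * norm (c 3) + 2 * a4 * norm (c 4) + 2 * a5 * norm (c 5)"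
    unfolding norm_mult by (intro add_mono mult_right_mono assms norm_ge_zero)
  also have "\<dots> = a1 * norm (c 1) + a2 * norm (c 2) + a3 * (2 * norm (c 3)) + a4 * (2 * norm (c 4)) + a5 * (2 * norm (c 5))"
    by simp
  finally show ?thesis
    unfolding weighted_mass_def
    by (intro order.trans[OF power_mono Cauchy_Schwarz_5]) auto
qed

lemma norm_monomial_le: "norm (c 1 ^ k) \<le> 1" "norm (c 1 ^ k * c 2) \<le> 1"
  using norm_c_le_1 by (auto simp: norm_mult norm_power intro!: power_le_one mult_le_one)

text \<open>
  With \<open>u = c\<^sub>1\<^sup>2\<close>, the difference is \<open>(17/12)\<^sup>2 - (3/2)\<^sup>2 = -35/144\<close> times \<open>\<bar>u\<bar>\<^sup>2\<close>, plus
  \<open>2 (17/12 - 3/2) = -1/6\<close> times the real inner product of \<open>u\<close> and \<open>c\<^sub>2\<close>. The negative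
  term has to be kept: without it the total would exceed what the bound for \<open>a\<^sub>7\<close> permits.
\<close>

lemma energy_excess_2:
  "(norm (17/12 * c 1 ^ 2 + c 2))\<^sup>2 - (norm (3/2 * c 1 ^ 2 + c 2))\<^sup>2
     \<le> (norm (c 1))\<^sup>2 * norm (c 2) / 6 - 35/144 * (norm (c 1)) ^ 4"
proof -
  define u where "u = (c 1)\<^sup>2"
  have nu: "(norm (c 1))\<^sup>2 = norm u" "(norm (c 1)) ^ 4 = (norm u)\<^sup>2"
    by (simp_all add: u_def norm_power flip: power_mult)
  have "(norm (17/12 * u + c 2))\<^sup>2 - (norm (3/2 * u + c 2))\<^sup>2
      = - (35/144) * (norm u)\<^sup>2 - 1/6 * (u \<bullet> c 2)"
    unfolding cmod_power2 inner_complex_def by (simp add: power2_eq_square field_simps)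
  moreover have "- (u \<bullet> c 2) \<le> norm u * norm (c 2)"
    using Cauchy_Schwarz_ineq2[of u "c 2"] by linarith
  ultimately show ?thesis unfolding nu u_def[symmetric] by linarith
qed

text \<open>
  In the next three lemmas the polynomials on the two sides are \<open>e\<^sub>k\<close> and \<open>k b\<^sub>k\<close>, with
  \<open>\<theta> = 3/4, 2/3, 3/5\<close> for \<open>k = 3, 4, 5\<close>. The remainder \<open>?r = e\<^sub>k - \<theta> k b\<^sub>k\<close> is sorted by a factor
  \<open>c\<^sub>1, \<dots>, c\<^sub>5\<close> in each monomial, and the cofactors are bounded by rounding up their coefficients.
\<close>

lemma energy_excess_3:
  "(norm (19/18 * c 1 ^ 3 + 23/12 * c 1 * c 2 + 5/6 * c 3))\<^sup>2
     \<le> (norm (17/12 * c 1 ^ 3 + 5/2 * c 1 * c 2 + c 3))\<^sup>2 + 3/250 * weighted_mass c"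
proof -
  let ?r = "(- 1/144 * c 1 ^ 2) * c 1 + (1/24 * c 1 ^ 1) * c 2 + (1/12) * c 3 + 0 * c 4 + 0 * c 5"
  have "(norm ?r)\<^sup>2 \<le> ((1/100)\<^sup>2 + (1/20)\<^sup>2 + (1/20)\<^sup>2 + 0\<^sup>2 + 0\<^sup>2) * weighted_mass c"
    using norm_monomial_le(1)[of 2] norm_monomial_le(1)[of 1]
    by (intro remainder_bound) (simp_all add: norm_mult)
  then have "(norm ?r)\<^sup>2 \<le> (1 - (3/4)\<^sup>2) * (3/250 * weighted_mass c)"
    using weighted_mass_nonneg[of c] by (simp add: power2_eq_square)
  from norm_square_near_multiple[OF _ _ this, of "17/12 * c 1 ^ 3 + 5/2 * c 1 * c 2 + c 3"]
  show ?thesis by (simp add: algebra_simps power2_eq_square power3_eq_cube)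
qed

lemma energy_excess_4:
  "(norm (27/40 * c 1 ^ 4 + 13/6 * c 1 ^ 2 * c 2 + 19/12 * c 1 * c 3 + 2/3 * c 2 ^ 2 + 3/4 * c 4))\<^sup>2
     \<le> (norm (19/18 * c 1 ^ 4 + 10/3 * c 1 ^ 2 * c 2 + 7/3 * c 1 * c 3 + c 2 ^ 2 + c 4))\<^sup>2
       + 7/500 * weighted_mass c"
proof -
  let ?r = "(- 31/1080 * c 1 ^ 3) * c 1 + (- 1/18 * c 1 ^ 2) * c 2 + (1/36 * c 1 ^ 1) * c 3 + (1/12) * c 4 + 0 * c 5"
  have "(norm ?r)\<^sup>2 \<le> ((3/100)\<^sup>2 + (6/100)\<^sup>2 + (15/1000)\<^sup>2 + (5/100)\<^sup>2 + 0\<^sup>2) * weighted_mass c"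
    using norm_monomial_le(1)[of 3] norm_monomial_le(1)[of 2] norm_monomial_le(1)[of 1]
    by (intro remainder_bound) (simp_all add: norm_mult)
  then have "(norm ?r)\<^sup>2 \<le> (1 - (2/3)\<^sup>2) * (7/500 * weighted_mass c)"
    using weighted_mass_nonneg[of c] by (simp add: power2_eq_square)
  from norm_square_near_multiple[OF _ _ this,
      of "19/18 * c 1 ^ 4 + 10/3 * c 1 ^ 2 * c 2 + 7/3 * c 1 * c 3 + c 2 ^ 2 + c 4"]
  show ?thesis by (simp add: algebra_simps eval_nat_numeral)
qed

lemma energy_excess_5:
  "(norm (8351/21600 * c 1 ^ 5 + 1343/720 * c 1 ^ 3 * c 2 + 641/360 * c 1 ^ 2 * c 3 + 91/60 * c 1 * c 2 ^ 2
      + 169/120 * c 1 * c 4 + 67/60 * c 2 * c 3 + 7/10 * c 5))\<^sup>2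
     \<le> (norm (27/40 * c 1 ^ 5 + 29/9 * c 1 ^ 3 * c 2 + 3 * c 1 ^ 2 * c 3 + 31/12 * c 1 * c 2 ^ 2
      + 9/4 * c 1 * c 4 + 11/6 * c 2 * c 3 + c 5))\<^sup>2
       + 13/500 * weighted_mass c"
proof -
  let ?r = "(- 397/21600 * c 1 ^ 4) * c 1 + (- 49/720 * c 1 ^ 3 - 1/30 * (c 1 ^ 1 * c 2)) * c 2
    + (- 7/360 * c 1 ^ 2 + 1/60 * (c 1 ^ 0 * c 2)) * c 3 + (7/120 * c 1 ^ 1) * c 4 + (1/10) * c 5"
  have "(norm ?r)\<^sup>2 \<le> ((2/100)\<^sup>2 + (11/100)\<^sup>2 + (2/100)\<^sup>2 + (3/100)\<^sup>2 + (5/100)\<^sup>2) * weighted_mass c"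
  proof (rule remainder_bound)
    show "norm (- 49/720 * c 1 ^ 3 - 1/30 * (c 1 ^ 1 * c 2)) \<le> 11/100"
      using norm_triangle_ineq4[of "- 49/720 * c 1 ^ 3" "1/30 * (c 1 ^ 1 * c 2)"]
        norm_monomial_le(1)[of 3] norm_monomial_le(2)[of 1]
      by (simp only: norm_mult[of "- 49/720"] norm_mult[of "1/30"]) simp
    show "norm (- 7/360 * c 1 ^ 2 + 1/60 * (c 1 ^ 0 * c 2)) \<le> 2 * (2/100)"
      using norm_triangle_ineq[of "- 7/360 * c 1 ^ 2" "1/60 * (c 1 ^ 0 * c 2)"]
        norm_monomial_le(1)[of 2] norm_monomial_le(2)[of 0]
      by (simp only: norm_mult[of "- 7/360"] norm_mult[of "1/60"]) simp
  qed (use norm_monomial_le(1)[of 4] norm_monomial_le(1)[of 1] in \<open>simp_all add: norm_mult\<close>)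
  then have "(norm ?r)\<^sup>2 \<le> (1 - (3/5)\<^sup>2) * (13/500 * weighted_mass c)"
    using weighted_mass_nonneg[of c] by (simp add: power2_eq_square)
  from norm_square_near_multiple[OF _ _ this,
      of "27/40 * c 1 ^ 5 + 29/9 * c 1 ^ 3 * c 2 + 3 * c 1 ^ 2 * c 3 + 31/12 * c 1 * c 2 ^ 2
      + 9/4 * c 1 * c 4 + 11/6 * c 2 * c 3 + c 5"]
  show ?thesis by (simp add: algebra_simps eval_nat_numeral)
qed

text \<open>
  Write \<open>s = \<bar>c\<^sub>1\<bar>\<^sup>2\<close> and \<open>y = \<bar>c\<^sub>2\<bar>\<close>. The constant \<open>1\<close> is \<open>\<bar>e\<^sub>0\<bar>\<^sup>2\<close>, and \<open>5/4 s\<close> is the excess for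
  \<open>k = 1\<close>, where \<open>e\<^sub>1 = 3/2 c\<^sub>1\<close> and \<open>b\<^sub>1 = c\<^sub>1\<close>. After the mixed term \<open>s y / 6\<close> is split and \<open>y\<^sup>2\<close>
  is replaced by its largest value \<open>1 - s\<close>, a concave quadratic polynomial in \<open>s\<close> remains. Its values
  are at most about \<open>2.071\<close>; the round number \<open>83/40\<close> lies between this and \<open>(42 \<cdot> 0.0343723)\<^sup>2\<close>, which is
  about \<open>2.084\<close>.
\<close>

lemma total_excess:
  "1 + 5/4 * (norm (c 1))\<^sup>2 + ((norm (c 1))\<^sup>2 * norm (c 2) / 6 - 35/144 * (norm (c 1)) ^ 4)
     + 3/250 * weighted_mass c + 7/500 * weighted_mass c
     + 13/500 * weighted_mass c \<le> 83/40"
proof -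
  define s y t where "s = (norm (c 1))\<^sup>2" and "y = norm (c 2)"
    and "t = (2 * norm (c 3))\<^sup>2 + (2 * norm (c 4))\<^sup>2 + (2 * norm (c 5))\<^sup>2"
  have t: "0 \<le> t" "s + y\<^sup>2 + t / 4 \<le> 1"
    using mass by (simp_all add: s_def y_def t_def power_mult_distrib add_divide_distrib)
  have s: "(norm (c 1)) ^ 4 = s\<^sup>2" by (simp add: s_def flip: power_mult)
  have m: "weighted_mass c = s + y\<^sup>2 + t"
    by (simp add: weighted_mass_def s_def y_def t_def)
  \<comment> \<open>The split is sharp for \<open>s = 10 y\<close>, close to the critical \<open>s\<close> near \<open>1\<close> and small \<open>y\<close>.\<close>
  have "s * y / 6 \<le> s\<^sup>2 / 120 + 5/6 * y\<^sup>2"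
    using zero_le_power2[of "s - 10 * y"] by (simp add: power2_eq_square algebra_simps)
  \<comment> \<open>The remaining quadratic polynomial has its maximum near \<open>8/9\<close>; there \<open>- s\<^sup>2\<close> is replaced by its
    tangent.\<close>
  moreover have "0 \<le> (s - 8/9)\<^sup>2" by simp
  then have "16/9 * s - s\<^sup>2 \<le> 64/81"
    by (simp add: power2_eq_square algebra_simps)
  moreover have "0 \<le> s" "0 \<le> y\<^sup>2" by (simp_all add: s_def)
  ultimately show ?thesis
    using t unfolding m s s_def[symmetric] y_def[symmetric] distrib_left by linarith
qed

end

section \<open>Coefficient bounds\<close>

lemma schwarz_functionD:
  assumes "schwarz_function w"
  shows "w holomorphic_on unit_disc" "w 0 = 0" "z \<in> unit_disc \<Longrightarrow> norm (w z) \<le> 1"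
proof -
  have "norm (w z) \<le> norm z" if "z \<in> unit_disc"
    using assms that by (simp add: schwarz_function_def)
  then show "z \<in> unit_disc \<Longrightarrow> norm (w z) \<le> 1"
    by (meson less_imp_le mem_ball_0 order.trans)
qed (use assms in \<open>simp_all add: schwarz_function_def\<close>)

lemma schwarz_function_coeff_mass:
  assumes "schwarz_function w"
  shows "(\<Sum>k\<le>Suc n. (norm (fps_nth (fps_expansion w 0) k))\<^sup>2) \<le> 1"
proof -
  have "(\<Sum>k\<le>Suc n. (norm (fps_nth (fps_expansion (\<lambda>z. w z * 1) 0) k))\<^sup>2)
      \<le> (\<Sum>k<Suc n. (norm (fps_nth (fps_expansion (\<lambda>z. 1) 0) k))\<^sup>2)"
    by (intro Clunie_inequality schwarz_functionD[OF assms] holomorphic_intros)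
  moreover have "fps_expansion (\<lambda>z. 1) 0 = 1"
    by (intro fps_expansion_eqI has_fps_expansion_1)
  ultimately show ?thesis
    by (simp add: sum.lessThan_Suc_shift del: sum.lessThan_Suc)
qed

lemma class_C_e_coeff_bounds:
  assumes f: "f \<in> class_C_e" and a: "normalized_expansion f a"
  shows "(norm (30 * a 6))\<^sup>2 \<le> 83/40" "(norm (42 * a 7))\<^sup>2 \<le> 83/40"
proof -
  obtain w H where w: "schwarz_function w" and H: "H holomorphic_on unit_disc"
    and H_exp: "fps_expansion H 0 = fps_deriv (Abs_fps a) * (exp_quotient_fps oo fps_expansion w 0)"
    and wH_exp: "fps_expansion (\<lambda>z. w z * H z) 0 = fps_X * fps_deriv (fps_deriv (Abs_fps a))"
    by (rule class_C_e_factorization[OF f a])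
  define c where "c = fps_nth (fps_expansion w 0)"
  define q where "q = fps_nth (exp_quotient_fps oo fps_expansion w 0)"
  define e where "e = fps_nth (fps_expansion H 0)"
  define b where "b = fps_nth (fps_deriv (Abs_fps a))"
  have b_eq: "b n = of_nat (Suc n) * a (Suc n)" for n
    by (simp add: b_def)
  have w0: "fps_nth (fps_expansion w 0) 0 = 0"
    using w by (simp add: schwarz_function_def fps_expansion_def)
  have wH: "fps_nth (fps_expansion (\<lambda>z. w z * H z) 0) n = of_nat n * b n" for n
    by (simp add: wH_exp fps_mult_fps_X_deriv_shift b_def)
  have "fps_expansion (\<lambda>z. w z * H z) 0 = fps_expansion w 0 * fps_expansion H 0"
    by (intro fps_expansion_eqI has_fps_expansion_mult has_fps_expansion_fps_expansion[of unit_disc]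
        schwarz_functionD[OF w] H) simp_all
  then have b_rec: "of_nat n * b n = (\<Sum>i=0..n. c i * e (n - i))" for n
    using wH[of n] by (simp add: fps_mult_nth c_def e_def)
  have e_rec: "e n = (\<Sum>i=0..n. b i * q (n - i))" for n
    by (simp add: e_def H_exp fps_mult_nth b_def q_def)
  have "b 0 = 1" "c 0 = 0"
    using a w0 by (simp_all add: b_eq c_def normalized_expansion_def)
  note coeffs = coeffs_from_recurrences[OF exp_quotient_compose_coeffs[OF w0, folded c_def q_def]
      e_rec b_rec this]
  have mass: "(norm (c 1))\<^sup>2 + (norm (c 2))\<^sup>2 + (norm (c 3))\<^sup>2 + (norm (c 4))\<^sup>2 + (norm (c 5))\<^sup>2 \<le> 1"
    using schwarz_function_coeff_mass[OF w, of 4] \<open>c 0 = 0\<close>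
    by (simp add: c_def eval_nat_numeral)
  have energy: "(\<Sum>k\<le>n. (norm (of_nat k * b k))\<^sup>2) \<le> (\<Sum>k<n. (norm (e k))\<^sup>2)" for n
    using Clunie_inequality[OF schwarz_functionD[OF w] H, of n] by (simp only: wH e_def)
  have b1: "(norm (b 1))\<^sup>2 = (norm (c 1))\<^sup>2" "(norm (e 1))\<^sup>2 = 9/4 * (norm (c 1))\<^sup>2"
    by (simp_all only: coeffs norm_mult power_mult_distrib) (simp_all add: power2_eq_square)
  note bounds = energy_excess_2[OF mass, folded coeffs(4-11)] energy_excess_3[OF mass, folded coeffs(4-11)]
    energy_excess_4[OF mass, folded coeffs(4-11)] energy_excess_5[OF mass, folded coeffs(4-11)]
    total_excess[OF mass] weighted_mass_nonneg[of c] b1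
  have e0: "(norm (e 0))\<^sup>2 = 1" by (simp add: coeffs)
  \<comment> \<open>For \<open>n = 5\<close> the top term is \<open>5 b\<^sub>5 = 30 a\<^sub>6\<close>, for \<open>n = 6\<close> it is \<open>6 b\<^sub>6 = 42 a\<^sub>7\<close>; the total
    bound for \<open>n = 6\<close> serves for both, since it only adds nonnegative terms.\<close>
  have "(norm (b 1))\<^sup>2 + (norm (2 * b 2))\<^sup>2 + (norm (3 * b 3))\<^sup>2 + (norm (4 * b 4))\<^sup>2 + (norm (5 * b 5))\<^sup>2
      \<le> (norm (e 0))\<^sup>2 + (norm (e 1))\<^sup>2 + (norm (e 2))\<^sup>2 + (norm (e 3))\<^sup>2 + (norm (e 4))\<^sup>2"
    using energy[of 5] by (simp add: eval_nat_numeral)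
  then have "(norm (5 * b 5))\<^sup>2 \<le> 83/40"
    using bounds e0 by linarith
  then show "(norm (30 * a 6))\<^sup>2 \<le> 83/40"
    by (simp add: b_eq)
  have "(norm (b 1))\<^sup>2 + (norm (2 * b 2))\<^sup>2 + (norm (3 * b 3))\<^sup>2 + (norm (4 * b 4))\<^sup>2 + (norm (5 * b 5))\<^sup>2
      + (norm (6 * b 6))\<^sup>2
      \<le> (norm (e 0))\<^sup>2 + (norm (e 1))\<^sup>2 + (norm (e 2))\<^sup>2 + (norm (e 3))\<^sup>2 + (norm (e 4))\<^sup>2 + (norm (e 5))\<^sup>2"
    using energy[of 6] by (simp add: eval_nat_numeral)
  then have "(norm (6 * b 6))\<^sup>2 \<le> 83/40"
    using bounds e0 by linarith
  then show "(norm (42 * a 7))\<^sup>2 \<le> 83/40"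
    by (simp add: b_eq)
qed

theorem lemma3p4:
  fixes f :: "complex \<Rightarrow> complex" and a :: "nat \<Rightarrow> complex"
  assumes "f \<in> class_C_e"
    and "normalized_expansion f a"
  shows "norm (a 6) \<le> 587 / 10800 \<and> norm (a 7) \<le> 0.0343723"
proof
  note bounds = class_C_e_coeff_bounds[OF assms]
  show "norm (a 6) \<le> 587 / 10800"
    by (rule power2_le_imp_le) (use bounds(1) in \<open>simp_all add: norm_mult power_mult_distrib power_divide\<close>)
  show "norm (a 7) \<le> 0.0343723"
    by (rule power2_le_imp_le) (use bounds(2) in \<open>simp_all add: norm_mult power_mult_distrib power_divide\<close>)
qed

end
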